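(* Consider the two-site model $\dot x=f(x)+g_1(x)u_1+g_2(x)u_2$ with outputs $y_1=h_{\rm e}(x)$, $y_2=h_{\rm h}(x)$ defined in the context, let $D\subset X$ be an open set as in the context, and fix references $Y_1^{\rm ref},Y_2^{\rm ref}\in\mathbb{R}$. Consider the zero dynamics with respect to the set-point error $(y_1-Y_1^{\rm ref},\,y_2-Y_2^{\rm ref})$, i.e. the system $\dot\eta=F(\eta)$ on the state space $Z$, where $$F(\eta)=(F_1,F_2,F_3,F_4)^\top(\eta):=q\big([Y_1^{\rm ref},0,0,0,0]^\top,\,[Y_2^{\rm ref},0,0,0]^\top,\,\eta\big).$$ Suppose that the set $$\mathcal{I}=\{\eta\in Z \mid F_1(\eta)=F_2(\eta)=F_3(\eta)=0\}$$ is an embedded submanifold of $Z$. Then $\mathcal{I}$ is invariant with respect to the flow of $\dot\eta=F(\eta)$ (a solution starting in $\mathcal{I}$ stays in $\mathcal{I}$ as long as it is defined).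
   Context: **Model.** State $x=(x_{\rm g},x_{\rm e},x_{\rm h})\in X\subset\mathbb{R}^6\times\mathbb{R}^4\times\mathbb{R}^3$, where $X=\{x\in\mathbb{R}^{13}: x_{\rm h2}>0\}$; inputs $u_1,u_2\in\mathbb{R}$; $\dot x=f(x)+g_1u_1+g_2u_2$ with $f=(f_{\rm g},f_{\rm e},f_{\rm h})$ and $g_i=(g_{{\rm g}i},0,0)$. Parameters, for $i=1,2$: $T_{{\rm v}i},T_{{\rm f}i},T_{{\rm CD}i},T_{{\rm e}i},T_{\rm h1},T_{\rm h2},T_{\rm h3},K_{{\rm e}i},K_{{\rm h}i},D_i,\rho_{\rm s},\lambda,L,d,h_{\rm c}>0$; $0\le W_{{\rm o}i}<1$; $\beta_i\ge 0$; $Q'_{{\rm L}i}\in\mathbb{R}$; $E_1,E_2,E_\infty>0$; real $G_{ij},B_{ij}$ symmetric in $i,j\in\{1,2,\infty\}$ with $B_{1\infty},B_{2\infty}>0$. Functions: $P_{{\rm m}i}(w)=K_{{\rm e}i}(w-W_{{\rm o}i})/(1-W_{{\rm o}i})$; $Q'_{{\rm a}i}(w)=K_{{\rm h}i}(w+\beta_i)/(1+\beta_i)$; $Q'_{12}(w)=-Q'_{21}(w)=\frac{\pi}{4}h_{\rm c}\rho_{\rm s}w$; $P_{{\rm e}i}(\delta_1,\delta_2)=\sum_{j\in\{1,2,\infty\}}E_iE_j\{G_{ij}\cos(\delta_i-\delta_j)+B_{ij}\sin(\delta_i-\delta_j)\}$ with $\delta_\infty=0$; $P_{{\rm e}\infty}(\delta_1,\delta_2)=\sum_{i=1}^2E_\infty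 E_i\{B_{\infty i}\sin\delta_i-G_{\infty i}\cos\delta_i\}$. Vector fields: $f_{\rm g}=\big(\tfrac{-x_{\rm g1}+W_{\rm o1}}{T_{\rm v1}},\tfrac{-x_{\rm g2}+x_{\rm g1}}{T_{\rm f1}},\tfrac{-x_{\rm g3}+x_{\rm g2}}{T_{\rm CD1}},\tfrac{-x_{\rm g4}+W_{\rm o2}}{T_{\rm v2}},\tfrac{-x_{\rm g5}+x_{\rm g4}}{T_{\rm f2}},\tfrac{-x_{\rm g6}+x_{\rm g5}}{T_{\rm CD2}}\big)^\top$; $g_{\rm g1}=(\tfrac{1-W_{\rm o1}}{T_{\rm v1}},0,0,0,0,0)^\top$, $g_{\rm g2}=(0,0,0,\tfrac{1-W_{\rm o2}}{T_{\rm v2}},0,0)^\top$; $f_{\rm e}=\big(\tfrac{x_{\rm e2}}{T_{\rm e1}},\tfrac{P_{\rm m1}(x_{\rm g3})-D_1x_{\rm e2}-P_{\rm e1}(x_{\rm e1},x_{\rm e3})}{T_{\rm e1}},\tfrac{x_{\rm e4}}{T_{\rm e2}},\tfrac{P_{\rm m2}(x_{\rm g6})-D_2x_{\rm e4}-P_{\rm e2}(x_{\rm e1},x_{\rm e3})}{T_{\rm e2}}\big)^\top$; $f_{\rm h1}=\tfrac{Q'_{\rm a1}(x_{\rm g2})-Q'_{\rm L1}-Q'_{12}(x_{\rm h2})}{T_{\rm h1}}-\tfrac{Q'_{\rm a2}(x_{\rm g5})-Q'_{\rm L2}-Q'_{21}(x_{\rm h2})}{T_{\rm h2}}$, $f_{\rm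 h2}=\tfrac1{T_{\rm h3}}\big(\tfrac{x_{\rm h1}}{\rho_{\rm s}}-\tfrac{\lambda L}{2d}x_{\rm h2}|x_{\rm h2}|\big)$, $f_{\rm h3}=\tfrac{Q'_{\rm a1}(x_{\rm g2})-Q'_{\rm L1}+Q'_{\rm a2}(x_{\rm g5})-Q'_{\rm L2}}{T_{\rm h1}+T_{\rm h2}}$. Outputs: $h_{\rm e}(x)=P_{{\rm e}\infty}(x_{\rm e1},x_{\rm e3})$, $h_{\rm h}(x)=Q'_{12}(x_{\rm h2})$. **Normal-form coordinates.** $L_f$ denotes the Lie derivative along $f$. $\Phi(x)=(\xi_{\rm e},\xi_{\rm h},\eta)\in\mathbb{R}^5\times\mathbb{R}^4\times\mathbb{R}^4$ with $\xi_{\rm e}=[h_{\rm e},L_fh_{\rm e},\dots,L_f^4h_{\rm e}]^\top(x)$, $\xi_{\rm h}=[h_{\rm h},L_fh_{\rm h},L_f^2h_{\rm h},L_f^3h_{\rm h}]^\top(x)$, $\eta=[x_{\rm g3},x_{\rm e1},x_{\rm e2},x_{\rm h3}]^\top$. $D\subset X$ is an open set on which the model has vector relative degree $\{5,4\}$ with respect to $(y_1,y_2)$ and such that $\Phi$ restricted to $D$ is a diffeomorphism onto its image. **Zero dynamics.** $r(x)=[f_{\rm g3},f_{\rm e1},f_{\rm e2},f_{\rm h3}]^\top(x)$ and $q:=r\circ\Phi^{-1}$ on $\Phi(D)$. The state space of the zero dynamics is $Z=\{\eta\in\mathbb{R}^4:([Y_1^{\rm ref},0,0,0,0]^\top,[Y_2^{\rm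 ref},0,0,0]^\top,\eta)\in\Phi(D)\}$. *)

theory Defs
  imports "HOL-Analysis.Analysis"
begin

section \<open>Smooth maps, diffeomorphisms and embedded submanifolds\<close>

text \<open>Both notions below are meant for open \<open>S\<close>.\<close>

primrec C_diff_on :: "nat \<Rightarrow> 'a::euclidean_space set \<Rightarrow> ('a \<Rightarrow> 'b::euclidean_space) \<Rightarrow> bool" where
  "C_diff_on 0 S f \<longleftrightarrow> continuous_on S f"
| "C_diff_on (Suc n) S f \<longleftrightarrow>
     (\<forall>x\<in>S. f differentiable (at x)) \<and>
     (\<forall>v. C_diff_on n S (\<lambda>x. frechet_derivative f (at x) v))"

definition smooth_on :: "'a::euclidean_space set \<Rightarrow> ('a \<Rightarrow> 'b::euclidean_space) \<Rightarrow> bool" where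
  "smooth_on S f \<longleftrightarrow> (\<forall>n. C_diff_on n S f)"

definition diffeo_onto_image :: "('a::euclidean_space \<Rightarrow> 'b::euclidean_space) \<Rightarrow> 'a set \<Rightarrow> bool" where
  "diffeo_onto_image f S \<longleftrightarrow>
     open S \<and> open (f ` S) \<and> inj_on f S \<and> smooth_on S f \<and> smooth_on (f ` S) (the_inv_into S f)"

text \<open>\<open>S\<close> is an embedded submanifold of the open set \<open>M\<close>: around each of its points there is a
  chart of \<open>M\<close> in which \<open>S\<close> is a \<open>k\<close>-dimensional slice, with \<open>k\<close> the same for all points.\<close>

definition embedded_submanifold :: "'a::euclidean_space set \<Rightarrow> 'a set \<Rightarrow> bool" where
  "embedded_submanifold M S \<longleftrightarrow>
     S \<subseteq> M \<and>
     (\<exists>k. \<forall>p\<in>S. \<exists>U (\<phi> :: 'a \<Rightarrow> 'a) V.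
        open U \<and> p \<in> U \<and> U \<subseteq> M \<and> diffeo_onto_image \<phi> U \<and>
        subspace V \<and> dim V = k \<and> \<phi> ` (U \<inter> S) = \<phi> ` U \<inter> V)"


section \<open>Control-affine systems and autonomous differential equations\<close>

definition lie_deriv :: "('a::euclidean_space \<Rightarrow> 'a) \<Rightarrow> ('a \<Rightarrow> real) \<Rightarrow> 'a \<Rightarrow> real" where
  "lie_deriv f h = (\<lambda>x. frechet_derivative h (at x) (f x))"

text \<open>Vector relative degree at every point of the open set \<open>D\<close>. As \<open>D\<close> is open, requiring the
  vanishing conditions on all of \<open>D\<close> is the same as requiring them near each point of \<open>D\<close>.\<close>

definition has_vector_relative_degree ::
  "('a::euclidean_space \<Rightarrow> 'a) \<Rightarrow> ('m::finite \<Rightarrow> 'a \<Rightarrow> 'a) \<Rightarrow> ('m \<Rightarrow> 'a \<Rightarrow> real) \<Rightarrow> ('m \<Rightarrow> nat) \<Rightarrow> 'a set \<Rightarrow> bool"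
where
  "has_vector_relative_degree f g h \<rho> D \<longleftrightarrow>
     (\<forall>i. 1 \<le> \<rho> i) \<and>
     (\<forall>x\<in>D. (\<forall>i j k. k < \<rho> i - 1 \<longrightarrow> lie_deriv (g j) ((lie_deriv f ^^ k) (h i)) x = 0) \<and>
            det (\<chi> i j. lie_deriv (g j) ((lie_deriv f ^^ (\<rho> i - 1)) (h i)) x) \<noteq> 0)"

definition is_solution ::
  "('a::euclidean_space \<Rightarrow> 'a) \<Rightarrow> 'a set \<Rightarrow> real set \<Rightarrow> (real \<Rightarrow> 'a) \<Rightarrow> bool" where
  "is_solution F Z J \<gamma> \<longleftrightarrow>
     is_interval J \<and> (\<forall>t\<in>J. \<gamma> t \<in> Z \<and> (\<gamma> has_vector_derivative F (\<gamma> t)) (at t within J))"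

text \<open>The interval \<open>J\<close> may extend to either side of the initial time \<open>0\<close>.\<close>

definition flow_invariant :: "('a::euclidean_space \<Rightarrow> 'a) \<Rightarrow> 'a set \<Rightarrow> 'a set \<Rightarrow> bool" where
  "flow_invariant F Z S \<longleftrightarrow>
     S \<subseteq> Z \<and>
     (\<forall>J \<gamma>. is_solution F Z J \<gamma> \<and> 0 \<in> J \<and> \<gamma> 0 \<in> S \<longrightarrow> (\<forall>t\<in>J. \<gamma> t \<in> S))"


section \<open>The two-site model\<close>

datatype bus = Site 2 | Infinite_Bus

record params =
  T_v :: "2 \<Rightarrow> real"
  T_f :: "2 \<Rightarrow> real"
  T_CD :: "2 \<Rightarrow> real"
  T_e :: "2 \<Rightarrow> real"
  T_h :: "2 \<Rightarrow> real"
  T_h3 :: real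
  K_e :: "2 \<Rightarrow> real"
  K_h :: "2 \<Rightarrow> real"
  damping :: "2 \<Rightarrow> real"
  rho_s :: real
  friction :: real
  pipe_length :: real
  pipe_diameter :: real
  h_c :: real
  W_o :: "2 \<Rightarrow> real"
  beta :: "2 \<Rightarrow> real"
  Q_L :: "2 \<Rightarrow> real"
  E_bus :: "bus \<Rightarrow> real"
  G_bus :: "bus \<Rightarrow> bus \<Rightarrow> real"
  B_bus :: "bus \<Rightarrow> bus \<Rightarrow> real"

text \<open>\<open>damping\<close>, \<open>friction\<close>, \<open>pipe_length\<close>, \<open>pipe_diameter\<close> are the parameters
  \<open>D\<^sub>i\<close>, \<open>\<lambda>\<close>, \<open>L\<close>, \<open>d\<close>.\<close>

definition admissible :: "params \<Rightarrow> bool" where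
  "admissible p \<longleftrightarrow>
     (\<forall>i. T_v p i > 0 \<and> T_f p i > 0 \<and> T_CD p i > 0 \<and> T_e p i > 0 \<and> T_h p i > 0 \<and>
          K_e p i > 0 \<and> K_h p i > 0 \<and> damping p i > 0 \<and>
          0 \<le> W_o p i \<and> W_o p i < 1 \<and> beta p i \<ge> 0) \<and>
     T_h3 p > 0 \<and> rho_s p > 0 \<and> friction p > 0 \<and> pipe_length p > 0 \<and> pipe_diameter p > 0 \<and> h_c p > 0 \<and>
     (\<forall>a. E_bus p a > 0) \<and>
     (\<forall>a b. G_bus p a b = G_bus p b a) \<and>
     (\<forall>a b. B_bus p a b = B_bus p b a) \<and>
     (\<forall>i. B_bus p (Site i) Infinite_Bus > 0)"

definition P_m :: "params \<Rightarrow> 2 \<Rightarrow> real \<Rightarrow> real" where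
  "P_m p i w = K_e p i * (w - W_o p i) / (1 - W_o p i)"

definition Q_a :: "params \<Rightarrow> 2 \<Rightarrow> real \<Rightarrow> real" where
  "Q_a p i w = K_h p i * (w + beta p i) / (1 + beta p i)"

definition Q_12 :: "params \<Rightarrow> real \<Rightarrow> real" where
  "Q_12 p w = pi / 4 * h_c p * rho_s p * w"

definition Q_21 :: "params \<Rightarrow> real \<Rightarrow> real" where
  "Q_21 p w = - Q_12 p w"

definition angle :: "real \<Rightarrow> real \<Rightarrow> bus \<Rightarrow> real" where
  "angle \<delta>1 \<delta>2 a = (case a of Site i \<Rightarrow> (if i = 1 then \<delta>1 else \<delta>2) | Infinite_Bus \<Rightarrow> 0)"

definition P_e :: "params \<Rightarrow> 2 \<Rightarrow> real \<Rightarrow> real \<Rightarrow> real" where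
  "P_e p i \<delta>1 \<delta>2 =
     (\<Sum>b\<in>{Site 1, Site 2, Infinite_Bus}. E_bus p (Site i) * E_bus p b *
        (G_bus p (Site i) b * cos (angle \<delta>1 \<delta>2 (Site i) - angle \<delta>1 \<delta>2 b) +
         B_bus p (Site i) b * sin (angle \<delta>1 \<delta>2 (Site i) - angle \<delta>1 \<delta>2 b)))"

definition P_e_inf :: "params \<Rightarrow> real \<Rightarrow> real \<Rightarrow> real" where
  "P_e_inf p \<delta>1 \<delta>2 =
     (\<Sum>i\<in>{1, 2}. E_bus p Infinite_Bus * E_bus p (Site i) *
        (B_bus p Infinite_Bus (Site i) * sin (angle \<delta>1 \<delta>2 (Site i)) -
         G_bus p Infinite_Bus (Site i) * cos (angle \<delta>1 \<delta>2 (Site i))))"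

type_synonym state = "(real^6) \<times> (real^4) \<times> (real^3)"

abbreviation x_g :: "state \<Rightarrow> real^6" where "x_g x \<equiv> fst x"
abbreviation x_e :: "state \<Rightarrow> real^4" where "x_e x \<equiv> fst (snd x)"
abbreviation x_h :: "state \<Rightarrow> real^3" where "x_h x \<equiv> snd (snd x)"

definition X :: "state set" where
  "X = {x. x_h x $ 2 > 0}"

definition f_g :: "params \<Rightarrow> state \<Rightarrow> real^6" where
  "f_g p x = vector
    [(- x_g x $ 1 + W_o p 1) / T_v p 1,
     (- x_g x $ 2 + x_g x $ 1) / T_f p 1,
     (- x_g x $ 3 + x_g x $ 2) / T_CD p 1,
     (- x_g x $ 4 + W_o p 2) / T_v p 2,
     (- x_g x $ 5 + x_g x $ 4) / T_f p 2,
     (- x_g x $ 6 + x_g x $ 5) / T_CD p 2]"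

definition f_e :: "params \<Rightarrow> state \<Rightarrow> real^4" where
  "f_e p x = vector
    [x_e x $ 2 / T_e p 1,
     (P_m p 1 (x_g x $ 3) - damping p 1 * x_e x $ 2 - P_e p 1 (x_e x $ 1) (x_e x $ 3)) / T_e p 1,
     x_e x $ 4 / T_e p 2,
     (P_m p 2 (x_g x $ 6) - damping p 2 * x_e x $ 4 - P_e p 2 (x_e x $ 1) (x_e x $ 3)) / T_e p 2]"

definition f_h :: "params \<Rightarrow> state \<Rightarrow> real^3" where
  "f_h p x = vector
    [(Q_a p 1 (x_g x $ 2) - Q_L p 1 - Q_12 p (x_h x $ 2)) / T_h p 1
       - (Q_a p 2 (x_g x $ 5) - Q_L p 2 - Q_21 p (x_h x $ 2)) / T_h p 2,
     1 / T_h3 p * (x_h x $ 1 / rho_s p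
       - friction p * pipe_length p / (2 * pipe_diameter p) * x_h x $ 2 * \<bar>x_h x $ 2\<bar>),
     (Q_a p 1 (x_g x $ 2) - Q_L p 1 + Q_a p 2 (x_g x $ 5) - Q_L p 2) / (T_h p 1 + T_h p 2)]"

definition drift :: "params \<Rightarrow> state \<Rightarrow> state" where
  "drift p x = (f_g p x, f_e p x, f_h p x)"

definition input_field :: "params \<Rightarrow> 2 \<Rightarrow> state \<Rightarrow> state" where
  "input_field p i x =
     ((if i = 1 then vector [(1 - W_o p 1) / T_v p 1, 0, 0, 0, 0, 0]
       else vector [0, 0, 0, (1 - W_o p 2) / T_v p 2, 0, 0]), 0, 0)"

definition h_e :: "params \<Rightarrow> state \<Rightarrow> real" where
  "h_e p x = P_e_inf p (x_e x $ 1) (x_e x $ 3)"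

definition h_h :: "params \<Rightarrow> state \<Rightarrow> real" where
  "h_h p x = Q_12 p (x_h x $ 2)"

definition output_map :: "params \<Rightarrow> 2 \<Rightarrow> state \<Rightarrow> real" where
  "output_map p i = (if i = 1 then h_e p else h_h p)"


section \<open>Normal-form coordinates and zero dynamics\<close>

type_synonym normal_coords = "(real^5) \<times> (real^4) \<times> (real^4)"

definition Phi :: "params \<Rightarrow> state \<Rightarrow> normal_coords" where
  "Phi p x =
     (vector [h_e p x,
              lie_deriv (drift p) (h_e p) x,
              (lie_deriv (drift p) ^^ 2) (h_e p) x,
              (lie_deriv (drift p) ^^ 3) (h_e p) x,
              (lie_deriv (drift p) ^^ 4) (h_e p) x],
      vector [h_h p x,
              lie_deriv (drift p) (h_h p) x,
              (lie_deriv (drift p) ^^ 2) (h_h p) x,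
              (lie_deriv (drift p) ^^ 3) (h_h p) x],
      vector [x_g x $ 3, x_e x $ 1, x_e x $ 2, x_h x $ 3])"

definition r_field :: "params \<Rightarrow> state \<Rightarrow> real^4" where
  "r_field p x = vector [f_g p x $ 3, f_e p x $ 1, f_e p x $ 2, f_h p x $ 3]"

definition q_field :: "params \<Rightarrow> state set \<Rightarrow> normal_coords \<Rightarrow> real^4" where
  "q_field p D = r_field p \<circ> the_inv_into D (Phi p)"

definition zd_point :: "real \<Rightarrow> real \<Rightarrow> real^4 \<Rightarrow> normal_coords" where
  "zd_point Y1 Y2 \<eta> = (vector [Y1, 0, 0, 0, 0], vector [Y2, 0, 0, 0], \<eta>)"

definition zd_space :: "params \<Rightarrow> state set \<Rightarrow> real \<Rightarrow> real \<Rightarrow> (real^4) set" where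
  "zd_space p D Y1 Y2 = {\<eta>. zd_point Y1 Y2 \<eta> \<in> Phi p ` D}"

definition zd_field :: "params \<Rightarrow> state set \<Rightarrow> real \<Rightarrow> real \<Rightarrow> real^4 \<Rightarrow> real^4" where
  "zd_field p D Y1 Y2 \<eta> = q_field p D (zd_point Y1 Y2 \<eta>)"

definition zd_inv_set :: "params \<Rightarrow> state set \<Rightarrow> real \<Rightarrow> real \<Rightarrow> (real^4) set" where
  "zd_inv_set p D Y1 Y2 =
     {\<eta> \<in> zd_space p D Y1 Y2.
        zd_field p D Y1 Y2 \<eta> $ 1 = 0 \<and> zd_field p D Y1 Y2 \<eta> $ 2 = 0 \<and> zd_field p D Y1 Y2 \<eta> $ 3 = 0}"

end

theory Submission
  imports Defs
begin

text \<open>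
  Neither the drift nor the outputs depend on the state variable \<open>x\<^sub>h\<^sub>3\<close>. Hence \<open>\<Phi>\<close> commutes with
  translations in that variable, and the zero-dynamics field \<open>F\<close> is locally constant along
  the last coordinate of \<open>\<eta>\<close>. At a point \<open>\<eta>\<close> of the invariant set \<open>F \<eta>\<close> points in this very
  direction, so the line \<open>t \<mapsto> \<eta> + t F \<eta>\<close> is, for small \<open>t\<close>, a solution inside the set. As \<open>F\<close> is
  locally Lipschitz, it is the only solution through \<open>\<eta>\<close>; so the times a solution spends in the
  set form an open, and by continuity of \<open>F\<close> also closed, subset of its interval of definition.
\<close>

section \<open>Local uniqueness of solutions\<close>

lemma is_solution_subset:
  assumes "is_solution F Z J \<gamma>" "K \<subseteq> J" "is_interval K"
  shows "is_solution F Z K \<gamma>"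
  using assms unfolding is_solution_def
  by (meson has_vector_derivative_within_subset subsetD)

lemma is_solution_continuous_on:
  assumes "is_solution F Z J \<gamma>"
  shows "continuous_on J \<gamma>"
  using assms unfolding is_solution_def continuous_on_eq_continuous_within
  by (blast intro: has_vector_derivative_continuous)

text \<open>Contraction argument: on a segment from \<open>t0\<close> short enough that
  \<open>L\<close> times its length is at most 1/2, the mean value inequality bounds the maximum of
  \<open>norm (\<gamma> s - \<sigma> s)\<close> by half of itself. Derivatives are taken within
  \<open>J\<close>, so \<open>t0\<close> may be an endpoint.\<close>

lemma solutions_agree_nearby:
  fixes \<gamma> \<sigma> :: "real \<Rightarrow> 'a::euclidean_space"
  assumes \<gamma>: "is_solution F Z J \<gamma>" and \<sigma>: "is_solution F Z J \<sigma>"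
    and t0: "t0 \<in> J" "\<gamma> t0 = \<sigma> t0"
    and lip: "0 < e" "L-lipschitz_on (ball (\<sigma> t0) e \<inter> Z) F"
  shows "\<exists>d>0. \<forall>t\<in>J. \<bar>t - t0\<bar> < d \<longrightarrow> \<gamma> t = \<sigma> t"
proof -
  have J: "is_interval J" and inZ: "\<And>t. t \<in> J \<Longrightarrow> \<gamma> t \<in> Z \<and> \<sigma> t \<in> Z"
    using \<gamma> \<sigma> by (auto simp: is_solution_def)
  have "L \<ge> 0" using lip(2) by (rule lipschitz_on_nonneg)
  obtain d1 where d1: "d1 > 0" "\<And>t. t \<in> J \<Longrightarrow> dist t t0 < d1 \<Longrightarrow> dist (\<gamma> t) (\<gamma> t0) < e"
    using is_solution_continuous_on[OF \<gamma>] t0(1) lip(1) unfolding continuous_on_iff by metis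
  obtain d2 where d2: "d2 > 0" "\<And>t. t \<in> J \<Longrightarrow> dist t t0 < d2 \<Longrightarrow> dist (\<sigma> t) (\<sigma> t0) < e"
    using is_solution_continuous_on[OF \<sigma>] t0(1) lip(1) unfolding continuous_on_iff by metis
  \<comment> \<open>\<open>d1\<close> and \<open>d2\<close> keep both curves in the ball where the
    Lipschitz bound holds. The last term makes \<open>L * d\<close> at most 1/2; the summand 1 keeps
    the denominator positive when \<open>L = 0\<close>.\<close>
  define d where "d = min (min d1 d2) (1 / (2 * (L + 1)))"
  have "d > 0" using d1(1) d2(1) \<open>L \<ge> 0\<close> by (simp add: d_def)
  moreover have "\<gamma> t = \<sigma> t" if t: "t \<in> J" "\<bar>t - t0\<bar> < d" for t
  proof -
    \<comment> \<open>The segment treats times before and after \<open>t0\<close> alike. Compactness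
      yields a maximum of \<open>norm (u s)\<close>, convexity the mean value inequality.\<close>
    define K where "K = closed_segment t0 t"
    define u where "u = (\<lambda>s. \<gamma> s - \<sigma> s)"
    have KJ: "K \<subseteq> J"
      unfolding K_def using J t(1) t0(1)
      by (simp add: closed_segment_subset is_interval_convex_1)
    have Kd: "\<bar>s - t0\<bar> < d" if "s \<in> K" for s
      using that t(2) by (auto simp: K_def closed_segment_eq_real_ivl split: if_splits)
    have cont: "continuous_on K (\<lambda>s. norm (u s))"
      unfolding u_def
      by (intro continuous_intros continuous_on_subset[OF is_solution_continuous_on[OF \<gamma>] KJ]
          continuous_on_subset[OF is_solution_continuous_on[OF \<sigma>] KJ])
    have "compact K" "K \<noteq> {}" by (auto simp: K_def)
    then obtain m where m: "m \<in> K" "\<And>s. s \<in> K \<Longrightarrow> norm (u s) \<le> norm (u m)"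
      using continuous_attains_sup[OF _ _ cont] by blast
    define v where "v = (\<lambda>s. F (\<gamma> s) - F (\<sigma> s))"
    have v: "norm (v s) \<le> L * norm (u m)" if s: "s \<in> K" for s
    proof -
      have "\<gamma> s \<in> ball (\<sigma> t0) e \<inter> Z" "\<sigma> s \<in> ball (\<sigma> t0) e \<inter> Z"
        using d1(2)[of s] d2(2)[of s] Kd[OF s] s KJ inZ[of s] t0(2)
        by (auto simp: d_def dist_real_def dist_commute subset_iff)
      then have "norm (v s) \<le> L * norm (u s)"
        using lipschitz_on_normD[OF lip(2)] by (simp add: v_def u_def)
      also have "\<dots> \<le> L * norm (u m)" using m(2)[OF s] \<open>L \<ge> 0\<close> by (rule mult_left_mono)
      finally show ?thesis .
    qed
    have der: "(u has_derivative (\<lambda>h. h *\<^sub>R v s)) (at s within K)" if "s \<in> K" for s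
      using is_solution_subset[OF \<gamma> KJ] is_solution_subset[OF \<sigma> KJ] that
      unfolding u_def v_def has_vector_derivative_def[symmetric] is_solution_def
      by (auto intro!: has_vector_derivative_diff simp: K_def is_interval_convex_1)
    have on: "onorm (\<lambda>h. h *\<^sub>R v s) \<le> L * norm (u m)" if "s \<in> K" for s
      using v[OF that] by (intro onorm_bound) (auto simp: mult.commute mult_left_mono \<open>L \<ge> 0\<close>)
    \<comment> \<open>Since \<open>u t0 = 0\<close>, the left side is the maximum
      \<open>norm (u m)\<close> itself, which therefore absorbs into the right side.\<close>
    have mvt: "norm (u m - u t0) \<le> L * norm (u m) * norm (m - t0)"
      using der on m(1) by (intro differentiable_bound[where S = K]) (auto simp: K_def)
    have "L * \<bar>m - t0\<bar> \<le> L * (1 / (2 * (L + 1)))"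
      using Kd[OF m(1)] \<open>L \<ge> 0\<close> by (intro mult_left_mono) (auto simp: d_def)
    also have "\<dots> \<le> 1 / 2" using \<open>L \<ge> 0\<close> by (simp add: field_simps)
    finally have "L * \<bar>m - t0\<bar> * norm (u m) \<le> 1 / 2 * norm (u m)"
      by (rule mult_right_mono) simp
    moreover have "norm (u m) \<le> L * \<bar>m - t0\<bar> * norm (u m)"
      using mvt by (simp add: u_def t0(2) mult_ac)
    ultimately have "norm (u m) = 0" using norm_ge_zero[of "u m"] by linarith
    moreover have "t \<in> K" by (simp add: K_def)
    ultimately have "u t = 0" using m(2)[of t] by simp
    then show ?thesis by (simp add: u_def)
  qed
  ultimately show ?thesis by blast
qed

text \<open>The clopen argument in a form free of the model. By \<open>straight\<close>, the field
  is constant on a short line through \<open>z\<close> in its own direction, so that line is a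
  solution inside \<open>S\<close>; \<open>lip\<close> forces every other solution through
  \<open>z\<close> to follow it for a while.\<close>

lemma flow_invariant_if_straight:
  fixes F :: "'a::euclidean_space \<Rightarrow> 'a"
  assumes closed: "closedin (top_of_set Z) S"
    and lip: "\<And>z. z \<in> Z \<Longrightarrow> \<exists>e>0. \<exists>L. L-lipschitz_on (ball z e \<inter> Z) F"
    and straight: "\<And>z. z \<in> S \<Longrightarrow> \<exists>e>0. \<forall>s. \<bar>s\<bar> < e \<longrightarrow> z + s *\<^sub>R F z \<in> S \<and> F (z + s *\<^sub>R F z) = F z"
  shows "flow_invariant F Z S"
proof -
  have "S \<subseteq> Z" using closed by (rule closedin_imp_subset)
  moreover have "\<forall>t\<in>J. \<gamma> t \<in> S" if \<gamma>: "is_solution F Z J \<gamma>" and J0: "0 \<in> J" "\<gamma> 0 \<in> S" for J \<gamma>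
  proof -
    have J: "is_interval J" using \<gamma> by (simp add: is_solution_def)
    define A where "A = J \<inter> \<gamma> -` S"
    have "closedin (top_of_set J) A"
      unfolding A_def using \<gamma>
      by (intro continuous_closedin_preimage_gen[OF is_solution_continuous_on[OF \<gamma>] _ closed])
        (auto simp: is_solution_def)
    \<comment> \<open>Openness relative to \<open>J\<close> covers interior times and endpoints of
      \<open>J\<close> at once.\<close>
    moreover have "openin (top_of_set J) A"
      unfolding openin_euclidean_subtopology_iff
    proof (intro conjI ballI)
      fix t0 assume "t0 \<in> A"
      then have t0: "t0 \<in> J" "\<gamma> t0 \<in> S" by (auto simp: A_def)
      obtain e where e: "e > 0"
        "\<And>s. \<bar>s\<bar> < e \<Longrightarrow> \<gamma> t0 + s *\<^sub>R F (\<gamma> t0) \<in> S \<and> F (\<gamma> t0 + s *\<^sub>R F (\<gamma> t0)) = F (\<gamma> t0)"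
        using straight[OF t0(2)] by blast
      \<comment> \<open>The competitor is the straight line that passes through
        \<open>\<gamma> t0\<close> at time \<open>t0\<close>. It is known to be a solution only for
        times closer than \<open>e\<close> to \<open>t0\<close>, hence the restriction to
        \<open>K\<close>.\<close>
      define \<sigma> where "\<sigma> = (\<lambda>t. \<gamma> t0 + (t - t0) *\<^sub>R F (\<gamma> t0))"
      define K where "K = J \<inter> ball t0 e"
      have K: "is_interval K"
        unfolding K_def using J by (simp add: is_interval_convex_1 convex_Int)
      have \<sigma>S: "\<sigma> t \<in> S" "F (\<sigma> t) = F (\<gamma> t0)" if "t \<in> K" for t
        using that e(2)[of "t - t0"] by (auto simp: K_def \<sigma>_def dist_real_def abs_minus_commute)
      have "is_solution F Z K \<sigma>"
        unfolding is_solution_def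
      proof (intro conjI ballI K)
        fix t assume t: "t \<in> K"
        show "\<sigma> t \<in> Z" using \<sigma>S(1)[OF t] \<open>S \<subseteq> Z\<close> by blast
        show "(\<sigma> has_vector_derivative F (\<sigma> t)) (at t within K)"
          unfolding \<sigma>S(2)[OF t] unfolding \<sigma>_def
          by (auto intro!: derivative_eq_intros)
      qed
      moreover have "is_solution F Z K \<gamma>"
        using is_solution_subset[OF \<gamma> _ K] by (simp add: K_def)
      moreover have "t0 \<in> K" "\<gamma> t0 = \<sigma> t0" using t0(1) e(1) by (simp_all add: K_def \<sigma>_def)
      moreover obtain r L where "r > 0" "L-lipschitz_on (ball (\<sigma> t0) r \<inter> Z) F"
        using lip t0(2) \<open>S \<subseteq> Z\<close> \<open>\<gamma> t0 = \<sigma> t0\<close> by (metis subsetD)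
      ultimately obtain d where d: "d > 0" "\<And>t. t \<in> K \<Longrightarrow> \<bar>t - t0\<bar> < d \<Longrightarrow> \<gamma> t = \<sigma> t"
        using solutions_agree_nearby[of F Z K \<gamma> \<sigma> t0 r L] by blast
      show "\<exists>r>0. \<forall>t\<in>J. dist t t0 < r \<longrightarrow> t \<in> A"
      proof (intro exI[of _ "min d e"] conjI ballI impI)
        fix t assume t: "t \<in> J" "dist t t0 < min d e"
        then have "t \<in> K" by (simp add: K_def dist_commute)
        moreover have "\<bar>t - t0\<bar> < d" using t(2) by (simp add: dist_real_def)
        ultimately have "\<gamma> t \<in> S" using d(2) \<sigma>S(1) by metis
        then show "t \<in> A" using t(1) by (simp add: A_def)
      qed (use d(1) e(1) in simp)
    qed (simp add: A_def)
    moreover have "connected J" using J by (rule is_interval_connected)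
    ultimately have "A = {} \<or> A = J" by (simp add: connected_clopen)
    moreover have "0 \<in> A" using J0 by (simp add: A_def)
    ultimately have "A = J" by blast
    then show ?thesis by (auto simp: A_def)
  qed
  ultimately show ?thesis unfolding flow_invariant_def by blast
qed

section \<open>Lipschitz estimates\<close>

text \<open>Turns the smoothness of the inverse of \<open>Phi\<close> into a Lipschitz bound, by
  bounding the derivative on a compact ball.\<close>

lemma C1_imp_locally_lipschitz:
  fixes f :: "'a::euclidean_space \<Rightarrow> 'b::euclidean_space"
  assumes "open S" "x \<in> S" "C_diff_on 1 S f"
  shows "\<exists>e>0. \<exists>L. ball x e \<subseteq> S \<and> L-lipschitz_on (ball x e) f"
proof -
  obtain e where e: "e > 0" "cball x e \<subseteq> S"
    using assms(1,2) open_contains_cball by blast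
  define f' where "f' = (\<lambda>y. frechet_derivative f (at y))"
  have der: "(f has_derivative f' y) (at y)" if "y \<in> cball x e" for y
    using assms(3) e(2) that by (auto simp: f'_def frechet_derivative_works[symmetric])
  \<comment> \<open>\<open>C_diff_on\<close> gives continuity of the derivative only for each fixed
    direction \<open>b\<close>. Bounds for the basis directions are later summed to the operator
    bound \<open>L\<close>.\<close>
  have "\<exists>C. \<forall>y\<in>cball x e. norm (f' y b) \<le> C" for b
  proof -
    have "continuous_on (cball x e) (\<lambda>y. f' y b)"
      using assms(3) e(2) by (auto simp: f'_def intro: continuous_on_subset)
    then have "bounded ((\<lambda>y. f' y b) ` cball x e)"
      by (intro compact_imp_bounded compact_continuous_image) auto
    then show ?thesis by (auto simp: bounded_iff)
  qed
  then obtain C where C: "\<And>b y. y \<in> cball x e \<Longrightarrow> norm (f' y b) \<le> C b" by metis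
  define L where "L = (\<Sum>b\<in>Basis. C b)"
  have bound: "norm (f' y v) \<le> L * norm v" if y: "y \<in> cball x e" for y v
  proof -
    have lin: "linear (f' y)" using der[OF y] has_derivative_linear by blast
    have "f' y v = f' y (\<Sum>b\<in>Basis. (v \<bullet> b) *\<^sub>R b)" by (simp add: euclidean_representation)
    also have "\<dots> = (\<Sum>b\<in>Basis. (v \<bullet> b) *\<^sub>R f' y b)"
      by (simp add: linear_sum[OF lin] linear_scale[OF lin])
    also have "norm \<dots> \<le> (\<Sum>b\<in>Basis. norm v * C b)"
      using C[OF y] by (intro sum_norm_le) (auto intro!: mult_mono Basis_le_norm)
    finally show ?thesis by (simp add: L_def sum_distrib_left mult.commute)
  qed
  have "L \<ge> 0"
    unfolding L_def using C[of x] e(1) by (intro sum_nonneg) (auto intro: order_trans[OF norm_ge_zero])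
  have "L-lipschitz_on (cball x e) f"
    using der bound \<open>L \<ge> 0\<close>
    by (intro bounded_derivative_imp_lipschitz[where f' = f'])
      (auto intro: has_derivative_at_withinI onorm_bound)
  then have "L-lipschitz_on (ball x e) f" by (rule lipschitz_on_subset) auto
  then show ?thesis using e ball_subset_cball by blast
qed

section \<open>Closure rules for globally Lipschitz maps\<close>

text \<open>Hiding the constant lets the closure rules below be chained as introduction rules
  without computing any constants.\<close>

definition lipschitz :: "('a::metric_space \<Rightarrow> 'b::metric_space) \<Rightarrow> bool" where
  "lipschitz f \<longleftrightarrow> (\<exists>L. L-lipschitz_on UNIV f)"

lemma lipschitz_const: "lipschitz (\<lambda>x. c)"
  unfolding lipschitz_def using lipschitz_on_constant by blast

lemma lipschitz_add:
  fixes f g :: "'a::metric_space \<Rightarrow> 'b::real_normed_vector"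
  shows "lipschitz f \<Longrightarrow> lipschitz g \<Longrightarrow> lipschitz (\<lambda>x. f x + g x)"
  unfolding lipschitz_def using lipschitz_on_add by blast

lemma lipschitz_diff:
  fixes f g :: "'a::metric_space \<Rightarrow> 'b::real_normed_vector"
  shows "lipschitz f \<Longrightarrow> lipschitz g \<Longrightarrow> lipschitz (\<lambda>x. f x - g x)"
  unfolding lipschitz_def using lipschitz_on_diff by blast

lemma lipschitz_minus:
  fixes f :: "'a::metric_space \<Rightarrow> 'b::real_normed_vector"
  shows "lipschitz f \<Longrightarrow> lipschitz (\<lambda>x. - f x)"
  unfolding lipschitz_def using lipschitz_on_minus by blast

lemma lipschitz_cmult:
  fixes f :: "'a::metric_space \<Rightarrow> real"
  shows "lipschitz f \<Longrightarrow> lipschitz (\<lambda>x. c * f x)"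
  unfolding lipschitz_def using lipschitz_on_cmult_real by blast

lemma lipschitz_divide:
  fixes f :: "'a::metric_space \<Rightarrow> real"
  shows "lipschitz f \<Longrightarrow> lipschitz (\<lambda>x. f x / c)"
  using lipschitz_cmult[of f "inverse c"] by (simp add: divide_inverse mult.commute)

lemma lipschitz_sum:
  fixes f :: "'i \<Rightarrow> 'a::metric_space \<Rightarrow> 'b::real_normed_vector"
  shows "(\<And>i. i \<in> A \<Longrightarrow> lipschitz (f i)) \<Longrightarrow> lipschitz (\<lambda>x. \<Sum>i\<in>A. f i x)"
  by (induction A rule: infinite_finite_induct) (auto intro: lipschitz_const lipschitz_add)

lemma lipschitz_compose:
  "lipschitz g \<Longrightarrow> lipschitz f \<Longrightarrow> lipschitz (\<lambda>x. g (f x))"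
  unfolding lipschitz_def using lipschitz_on_compose2 lipschitz_on_subset by blast

lemma lipschitz_bounded_linear: "bounded_linear f \<Longrightarrow> lipschitz f"
  unfolding lipschitz_def by (metis bounded_linear.lipschitz_boundE)

lemma lipschitz_bounded_real_derivative:
  fixes f f' :: "real \<Rightarrow> real"
  assumes "\<And>x. (f has_real_derivative f' x) (at x)" "\<And>x. \<bar>f' x\<bar> \<le> 1"
  shows "lipschitz f"
proof -
  have "onorm ((*) (f' x)) \<le> 1" for x
    using assms(2)[of x] by (intro onorm_bound) (auto simp: abs_mult mult_left_le_one_le)
  then have "1-lipschitz_on UNIV f"
    using assms(1) unfolding has_field_derivative_def
    by (intro bounded_derivative_imp_lipschitz[where f' = "\<lambda>x. (*) (f' x)"]) auto
  then show ?thesis unfolding lipschitz_def by blast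
qed

lemma lipschitz_sin: "lipschitz f \<Longrightarrow> lipschitz (\<lambda>x. sin (f x :: real))"
  by (rule lipschitz_compose[OF lipschitz_bounded_real_derivative[where f' = cos]])
    (auto intro: DERIV_sin)

lemma lipschitz_cos: "lipschitz f \<Longrightarrow> lipschitz (\<lambda>x. cos (f x :: real))"
  by (rule lipschitz_compose[OF lipschitz_bounded_real_derivative[where f' = "\<lambda>x. - sin x"]])
    (auto intro: DERIV_cos)

lemma lipschitz_vec_component:
  fixes f :: "'a::metric_space \<Rightarrow> real^'n"
  shows "lipschitz f \<Longrightarrow> lipschitz (\<lambda>x. f x $ i)"
  by (rule lipschitz_compose[OF lipschitz_bounded_linear[OF bounded_linear_vec_nth]])

text \<open>Expanding \<open>f\<close> in the standard basis makes it a finite sum of bounded linear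
  images of its components.\<close>

lemma lipschitz_componentwise:
  fixes f :: "'a::metric_space \<Rightarrow> real^'n"
  assumes "\<And>i. lipschitz (\<lambda>x. f x $ i)"
  shows "lipschitz f"
proof -
  have "bounded_linear (\<lambda>r. r *\<^sub>R axis i 1 :: real^'n)" for i :: 'n
    by (rule bounded_linear_scaleR_left)
  then have "lipschitz (\<lambda>x. \<Sum>i\<in>UNIV. (f x $ i) *\<^sub>R (axis i 1 :: real^'n))"
    by (intro lipschitz_sum lipschitz_compose[OF lipschitz_bounded_linear assms])
  moreover have "(\<lambda>x. \<Sum>i\<in>UNIV. (f x $ i) *\<^sub>R (axis i 1 :: real^'n)) = f"
    by (simp add: basis_expansion scalar_mult_eq_scaleR[symmetric])
  ultimately show ?thesis by simp
qed

section \<open>Lipschitz property of the field \<open>r_field\<close>\<close>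

lemma vector_4:
  "(vector [a, b, c, d] :: 'a::zero^4) $ 1 = a"
  "(vector [a, b, c, d] :: 'a::zero^4) $ 2 = b"
  "(vector [a, b, c, d] :: 'a::zero^4) $ 3 = c"
  "(vector [a, b, c, d] :: 'a::zero^4) $ 4 = d"
  unfolding vector_def by simp_all

lemma vector_6_nth_3: "(vector [a, b, c, d, e, f] :: 'a::zero^6) $ 3 = c"
  unfolding vector_def by simp

text \<open>The four selected components are built from affine functions and from sines and cosines
  of angle differences. The quadratic friction term sits in the second component of
  \<open>f_h\<close>, which is not selected, so the bound is global.\<close>

lemma lipschitz_r_field: "lipschitz (r_field p)"
proof (rule lipschitz_componentwise)
  fix i :: 4
  have st: "lipschitz (\<lambda>x. x_g x $ k)" "lipschitz (\<lambda>x. x_e x $ l)" for k l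
    by (intro lipschitz_vec_component lipschitz_bounded_linear bounded_linear_fst
        bounded_linear_compose[OF bounded_linear_fst bounded_linear_snd])+
  have angle: "lipschitz (\<lambda>x. angle (x_e x $ 1) (x_e x $ 3) a)" for a
    by (cases a; cases "a = Site 1") (auto simp: angle_def intro: st lipschitz_const)
  \<comment> \<open>Each sine and cosine is multiplied only by parameters, so no rule for products
    of two state-dependent factors is required.\<close>
  have Pe: "lipschitz (\<lambda>x. P_e p 1 (x_e x $ 1) (x_e x $ 3))"
    unfolding P_e_def
    by (intro lipschitz_sum lipschitz_cmult lipschitz_add lipschitz_sin lipschitz_cos
        lipschitz_diff angle)
  consider "i = 1" | "i = 2" | "i = 3" | "i = 4" using exhaust_4 by blast
  then show "lipschitz (\<lambda>x. r_field p x $ i)"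
    by cases (auto simp: r_field_def f_g_def f_e_def f_h_def vector_4 vector_6_nth_3 P_m_def Q_a_def
        intro!: lipschitz_divide lipschitz_diff lipschitz_add lipschitz_cmult lipschitz_minus
        lipschitz_const st Pe)
qed

section \<open>Translation invariance in the last state variable\<close>

text \<open>\<open>frechet_derivative\<close> picks a derivative by choice. A map is a derivative of
  \<open>h\<close> at one point exactly if it is one at the other, so both choices coincide, even
  where no derivative exists.\<close>

lemma frechet_derivative_translate:
  assumes "\<And>x. h (x + v) = h x"
  shows "frechet_derivative h (at (x + v)) = frechet_derivative h (at x)"
proof -
  have "(h has_derivative h') (at (x + w))"
    if "\<And>y. h (y + w) = h y" "(h has_derivative h') (at x)" for h' x w
  proof -
    have "((\<lambda>y. y - w) has_derivative (\<lambda>y. y)) (at (x + w))"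
      by (auto intro!: derivative_eq_intros)
    moreover have "(h has_derivative h') (at (x + w - w))" using that(2) by simp
    ultimately have "((\<lambda>y. h (y - w)) has_derivative (\<lambda>y. h' y)) (at (x + w))"
      by (rule has_derivative_compose)
    moreover have "h (y - w) = h y" for y using that(1)[of "y - w"] by simp
    ultimately show ?thesis by simp
  qed
  \<comment> \<open>Translating by \<open>v\<close> from \<open>x\<close> and by \<open>- v\<close>
    from \<open>x + v\<close> gives the two directions of the equivalence.\<close>
  from this[OF assms] this[of "- v" _ "x + v"] assms
  have "(h has_derivative h') (at (x + v)) \<longleftrightarrow> (h has_derivative h') (at x)" for h'
    by (metis add_uminus_conv_diff diff_add_cancel add_diff_cancel)
  then show ?thesis by (simp add: frechet_derivative_def)
qed

text \<open>A Lie derivative combines the derivative of \<open>h\<close> with the value of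
  \<open>f\<close>, both unchanged by the translation, so the invariance passes to every
  order.\<close>

lemma lie_deriv_funpow_translate:
  assumes f: "\<And>x. f (x + v) = f x" and h: "\<And>x. h (x + v) = h x"
  shows "(lie_deriv f ^^ n) h (x + v) = (lie_deriv f ^^ n) h x"
proof (induction n arbitrary: x)
  case (Suc n)
  then show ?case
    using frechet_derivative_translate[of "(lie_deriv f ^^ n) h" v x] f
    by (simp add: lie_deriv_def[of f "(lie_deriv f ^^ n) h"])
qed (simp add: h)

section \<open>Translation of the model along the third component of \<open>x_h\<close>\<close>

definition h3_shift :: "real \<Rightarrow> state" where
  "h3_shift s = (0, 0, s *\<^sub>R axis 3 1)"

lemma h3_shift_simps [simp]:
  "x_g (h3_shift s) = 0"
  "x_e (h3_shift s) = 0"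
  "x_h (h3_shift s) $ 1 = 0"
  "x_h (h3_shift s) $ 2 = 0"
  "x_h (h3_shift s) $ 3 = s"
  by (simp_all add: h3_shift_def axis_def)

lemma drift_translate: "drift p (x + h3_shift s) = drift p x"
  by (simp add: drift_def f_g_def f_e_def f_h_def)

lemma r_field_translate: "r_field p (x + h3_shift s) = r_field p x"
  by (simp add: r_field_def f_g_def f_e_def f_h_def)

text \<open>The first two blocks are iterated Lie derivatives of the outputs and stay fixed. Only
  the fourth entry of the last block, which is the shifted variable itself, moves.\<close>

lemma Phi_translate: "Phi p (x + h3_shift s) = Phi p x + (0, 0, s *\<^sub>R axis 4 1)"
proof -
  have "(lie_deriv (drift p) ^^ n) (h_e p) (x + h3_shift s) = (lie_deriv (drift p) ^^ n) (h_e p) x"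
    "(lie_deriv (drift p) ^^ n) (h_h p) (x + h3_shift s) = (lie_deriv (drift p) ^^ n) (h_h p) x" for n
    by (rule lie_deriv_funpow_translate; simp add: drift_translate h_e_def h_h_def)+
  \<comment> \<open>\<open>Phi\<close> writes orders 0 and 1 without iteration, so these two
    instances are supplied separately for simplification.\<close>
  note this[of 0] this[of 1] this
  moreover have "(vector [a, b, c, d + s] :: real^4) = vector [a, b, c, d] + s *\<^sub>R axis 4 1"
    for a b c d
    by (simp add: vec_eq_iff forall_4 vector_4 axis_def)
  ultimately show ?thesis by (simp add: Phi_def)
qed

text \<open>The preimage \<open>x\<close> of the point over \<open>\<eta>\<close> can be shifted
  inside the open set \<open>D\<close>. Its image then lies over the shifted \<open>\<eta>\<close>,
  with unchanged output coordinates, and \<open>r_field\<close> does not see the shift.\<close>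

lemma zd_field_translate:
  assumes "open D" "inj_on (Phi p) D" "\<eta> \<in> zd_space p D Y1 Y2"
  shows "\<exists>e>0. \<forall>s. \<bar>s\<bar> < e \<longrightarrow> \<eta> + s *\<^sub>R axis 4 1 \<in> zd_space p D Y1 Y2 \<and>
    zd_field p D Y1 Y2 (\<eta> + s *\<^sub>R axis 4 1) = zd_field p D Y1 Y2 \<eta>"
proof -
  obtain x where x: "x \<in> D" "Phi p x = zd_point Y1 Y2 \<eta>"
    using assms(3) by (auto simp: zd_space_def)
  obtain e where e: "e > 0" "ball x e \<subseteq> D"
    using assms(1) x(1) open_contains_ball by blast
  have "\<eta> + s *\<^sub>R axis 4 1 \<in> zd_space p D Y1 Y2 \<and>
    zd_field p D Y1 Y2 (\<eta> + s *\<^sub>R axis 4 1) = zd_field p D Y1 Y2 \<eta>" if "\<bar>s\<bar> < e" for s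
  proof -
    have "norm (h3_shift s) = \<bar>s\<bar>" by (simp add: h3_shift_def norm_Pair)
    then have xs: "x + h3_shift s \<in> D" using e(2) that by (intro subsetD[OF e(2)]) (simp add: dist_norm)
    have Ps: "Phi p (x + h3_shift s) = zd_point Y1 Y2 (\<eta> + s *\<^sub>R axis 4 1)"
      by (simp add: Phi_translate x(2) zd_point_def)
    have "the_inv_into D (Phi p) (zd_point Y1 Y2 \<eta>) = x"
      using the_inv_into_f_f[OF assms(2) x(1)] by (simp add: x(2))
    moreover have "the_inv_into D (Phi p) (zd_point Y1 Y2 (\<eta> + s *\<^sub>R axis 4 1)) = x + h3_shift s"
      using the_inv_into_f_f[OF assms(2) xs] by (simp add: Ps)
    ultimately show ?thesis
      using xs Ps[symmetric]
      by (auto simp: zd_field_def q_field_def r_field_translate zd_space_def)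
  qed
  then show ?thesis using e(1) by blast
qed

section \<open>The zero dynamics\<close>

text \<open>The field is a composition of three maps: the embedding \<open>zd_point\<close>, the
  inverse of \<open>Phi\<close>, which is smooth on an open set, and the globally Lipschitz
  \<open>r_field\<close>.\<close>

lemma zd_field_locally_lipschitz:
  assumes "diffeo_onto_image (Phi p) D" "\<eta> \<in> zd_space p D Y1 Y2"
  shows "\<exists>e>0. \<exists>L. L-lipschitz_on (ball \<eta> e) (zd_field p D Y1 Y2)"
proof -
  let ?\<zeta> = "zd_point Y1 Y2" and ?\<Psi> = "the_inv_into D (Phi p)"
  have "open (Phi p ` D)" "C_diff_on 1 (Phi p ` D) ?\<Psi>" "?\<zeta> \<eta> \<in> Phi p ` D"
    using assms by (auto simp: diffeo_onto_image_def smooth_on_def zd_space_def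
        simp del: One_nat_def C_diff_on.simps)
  then obtain e L where e: "e > 0" "L-lipschitz_on (ball (?\<zeta> \<eta>) e) ?\<Psi>"
    using C1_imp_locally_lipschitz by blast
  obtain M where M: "M-lipschitz_on UNIV (r_field p)"
    using lipschitz_r_field lipschitz_def by blast
  \<comment> \<open>The embedding is an isometry because its first two blocks are constant; thus one
    radius \<open>e\<close> serves in both spaces.\<close>
  have dist: "dist (?\<zeta> a) (?\<zeta> b) = dist a b" for a b
    by (simp add: zd_point_def dist_Pair_Pair)
  have \<zeta>: "1-lipschitz_on (ball \<eta> e) ?\<zeta>"
    by (rule lipschitz_onI) (auto simp: dist)
  have "?\<zeta> ` ball \<eta> e \<subseteq> ball (?\<zeta> \<eta>) e" by (auto simp: dist)
  then have "L-lipschitz_on (?\<zeta> ` ball \<eta> e) ?\<Psi>" using e(2) lipschitz_on_subset by blast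
  from lipschitz_on_compose2[OF \<zeta> this]
  have "(M * (L * 1))-lipschitz_on (ball \<eta> e) (\<lambda>x. r_field p (?\<Psi> (?\<zeta> x)))"
    by (rule lipschitz_on_compose2) (rule lipschitz_on_subset[OF M], simp)
  then show ?thesis using e(1) unfolding zd_field_def q_field_def o_def by blast
qed

theorem theorem1:
  fixes p :: params and D :: "state set" and Y1 Y2 :: real
  assumes "admissible p"
    and "open D" and "D \<subseteq> X"
    and "has_vector_relative_degree (drift p) (input_field p) (output_map p) (\<lambda>i. if i = 1 then 5 else 4) D"
    and "diffeo_onto_image (Phi p) D"
    and "embedded_submanifold (zd_space p D Y1 Y2) (zd_inv_set p D Y1 Y2)"
  shows "flow_invariant (zd_field p D Y1 Y2) (zd_space p D Y1 Y2) (zd_inv_set p D Y1 Y2)"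
proof -
  define F Z S where "F = zd_field p D Y1 Y2" and "Z = zd_space p D Y1 Y2"
    and "S = zd_inv_set p D Y1 Y2"
  have S: "S = {\<eta> \<in> Z. F \<eta> $ 1 = 0 \<and> F \<eta> $ 2 = 0 \<and> F \<eta> $ 3 = 0}"
    by (simp add: S_def Z_def F_def zd_inv_set_def)
  have inj: "inj_on (Phi p) D" using assms(5) by (simp add: diffeo_onto_image_def)
  have lip: "\<exists>e>0. \<exists>L. L-lipschitz_on (ball \<eta> e) F" if "\<eta> \<in> Z" for \<eta>
    using zd_field_locally_lipschitz[OF assms(5)] that by (simp add: F_def Z_def)
  have "flow_invariant F Z S"
  proof (rule flow_invariant_if_straight)
    have "continuous_on Z F"
      unfolding continuous_on_eq_continuous_within
    proof
      fix \<eta> assume "\<eta> \<in> Z"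
      then obtain e L where "e > 0" "L-lipschitz_on (ball \<eta> e) F" using lip by blast
      then have "continuous (at \<eta>) F"
        by (intro continuous_on_interior[OF lipschitz_on_continuous_on]) auto
      then show "continuous (at \<eta> within Z) F" by (rule continuous_at_imp_continuous_at_within)
    qed
    then have "closedin (top_of_set Z) {\<eta> \<in> Z. F \<eta> $ i = 0}" for i
      by (intro continuous_closedin_preimage_constant continuous_intros)
    moreover have "S = {\<eta> \<in> Z. F \<eta> $ 1 = 0} \<inter> {\<eta> \<in> Z. F \<eta> $ 2 = 0} \<inter> {\<eta> \<in> Z. F \<eta> $ 3 = 0}"
      by (auto simp: S)
    ultimately show "closedin (top_of_set Z) S" by (simp add: closedin_Int)
  next
    fix \<eta> assume "\<eta> \<in> Z"
    then show "\<exists>e>0. \<exists>L. L-lipschitz_on (ball \<eta> e \<inter> Z) F"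
      using lip lipschitz_on_subset by (metis Int_lower1)
  next
    fix \<eta> assume \<eta>: "\<eta> \<in> S"
    \<comment> \<open>On \<open>S\<close> only the fourth component of the field can be nonzero, and
      this is the direction along which the field is locally constant.\<close>
    then have F\<eta>: "F \<eta> = (F \<eta> $ 4) *\<^sub>R axis 4 1"
      by (simp add: S vec_eq_iff forall_4 axis_def)
    obtain e where e: "e > 0"
      "\<And>s. \<bar>s\<bar> < e \<Longrightarrow> \<eta> + s *\<^sub>R axis 4 1 \<in> Z \<and> F (\<eta> + s *\<^sub>R axis 4 1) = F \<eta>"
      using zd_field_translate[OF assms(2) inj, of \<eta> Y1 Y2] \<eta> unfolding S F_def Z_def by blast
    let ?c = "F \<eta> $ 4"
    \<comment> \<open>Time \<open>s\<close> displaces the last coordinate by \<open>s * ?c\<close>,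
      which must stay below \<open>e\<close>; the summand 1 covers the equilibrium case
      \<open>?c = 0\<close>.\<close>
    have "\<eta> + s *\<^sub>R F \<eta> \<in> S \<and> F (\<eta> + s *\<^sub>R F \<eta>) = F \<eta>" if "\<bar>s\<bar> < e / (\<bar>?c\<bar> + 1)" for s
    proof -
      have "\<bar>s\<bar> * (\<bar>?c\<bar> + 1) < e" using that by (simp add: pos_less_divide_eq)
      then have "\<bar>s * ?c\<bar> < e" by (simp add: abs_mult distrib_left)
      moreover have "s *\<^sub>R F \<eta> = (s * ?c) *\<^sub>R axis 4 1" by (subst F\<eta>) simp
      ultimately show ?thesis using e(2)[of "s * ?c"] \<eta> by (simp add: S)
    qed
    moreover have "e / (\<bar>?c\<bar> + 1) > 0" using e(1) by simp
    ultimately show "\<exists>e>0. \<forall>s. \<bar>s\<bar> < e \<longrightarrow> \<eta> + s *\<^sub>R F \<eta> \<in> S \<and> F (\<eta> + s *\<^sub>R F \<eta>) = F \<eta>"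
      by blast
  qed
  then show ?thesis by (simp add: F_def Z_def S_def)
qed

end
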